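(* Let $\omega$, $\mathcal{A}$, the polynomials $f_i$, their degree-$2\omega$ homogenizations $\bar f_i$, the matrices $Q^i$ ($i=0,\dots,m$), the cones $\mathbb{J}_p$ and the sets $S_p,\widetilde S_p,\overline S_p$ ($p=0,\dots,m$) be as defined in the context. Assume that $\mathbb{J}_{p-1}$ is a face of $\mathbb{CPP}^{\mathcal{A}}$ for some $p\in\{1,\dots,m\}$. (i) If $\inf\{\bar f_p(x): x\in\overline S_{p-1}\}\ge 0$, then $\mathbb{J}_p$ is a face of $\mathbb{J}_{p-1}$ and a face of $\mathbb{CPP}^{\mathcal{A}}$. (ii) If $\inf\{f_p(w): w\in S_{p-1}\}\ge 0$ and $\inf\{\bar f_p(0,w): w\in\widetilde S_{p-1}\}\ge 0$, then $\mathbb{J}_p$ is a face of $\mathbb{J}_{p-1}$ and a face of $\mathbb{CPP}^{\mathcal{A}}$.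
   Context: Let $f_0,\dots,f_m$ be real polynomials in $w=(w_1,\dots,w_n)\in\mathbb{R}^n$, and let $\omega$ be a positive integer with $2\omega\ge\max_i\deg f_i$. Points of $\mathbb{R}^{1+n}$ are written $x=(x_0,w)$ with $x_0\in\mathbb{R}$, $w\in\mathbb{R}^n$. For each $i$, $\bar f_i$ is the homogeneous polynomial of degree $2\omega$ in $x=(x_0,w)$ with $\bar f_i(1,w)=f_i(w)$ for all $w$ (each monomial of degree $\tau_0$ in $f_i$ is multiplied by $x_0^{2\omega-\tau_0}$). Let $\mathcal{A}_\omega=\{\alpha\in\mathbb{Z}^{1+n}_+:\sum_j\alpha_j=\omega\}$. Let $\mathcal{A}\subset\mathcal{A}_\omega$ be chosen to contain $\alpha^\omega=(\omega,0,\dots,0)$ and such that every monomial occurring in some $\bar f_i$ is of the form $x^{\alpha+\beta}$ with $\alpha,\beta\in\mathcal{A}$. $\mathbb{S}^{\mathcal{A}}$ is the space of real symmetric matrices indexed by $\mathcal{A}\times\mathcal{A}$, with inner product $\langle A,B\rangle=\sum_{\alpha,\beta}A_{\alpha\beta}B_{\alpha\beta}$. Let $u^{\mathcal{A}}(x)=(x^\alpha)_{\alpha\in\mathcal{A}}$ be the column vector of monomials, $\Gamma^{\mathcal{A}}=\{u^{\mathcal{A}}(x)u^{\mathcal{A}}(x)^T: x\in\mathbb{R}^{1+n}_+\}$, and $\mathbb{CPP}^{\mathcal{A}}=\mathrm{co}\,\Gamma^{\mathcal{A}}$ (convex hull). Choose $Q^i\in\mathbb{S}^{\mathcal{A}}$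 with $\bar f_i(x)=\langle Q^i,u^{\mathcal{A}}(x)u^{\mathcal{A}}(x)^T\rangle$ for all $x\in\mathbb{R}^{1+n}$ ($i=0,\dots,m$). Define $\mathbb{J}_0=\mathbb{CPP}^{\mathcal{A}}$ and $\mathbb{J}_p=\{X\in\mathbb{J}_{p-1}:\langle Q^p,X\rangle=0\}$ for $p=1,\dots,m$. Define $S_0=\widetilde S_0=\mathbb{R}^n_+$, $\overline S_0=\mathbb{R}^{1+n}_+$, and for $p=1,\dots,m$: $S_p=\{w\in S_{p-1}: f_p(w)=0\}$, $\widetilde S_p=\{w\in\widetilde S_{p-1}:\bar f_p(0,w)=0\}$, $\overline S_p=\{x\in\overline S_{p-1}:\bar f_p(x)=0\}$. The infimum over the empty set is $+\infty$. A convex cone $\mathbb{J}\subset\mathbb{C}$ is a face of a convex cone $\mathbb{C}$ if $X^1,X^2\in\mathbb{J}$ whenever $X^1,X^2\in\mathbb{C}$ and $X^1/2+X^2/2\in\mathbb{J}$ (the face $\mathbb{J}=\mathbb{C}$ is allowed). *)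

theory Defs
  imports "HOL-Analysis.Analysis" "HOL-Library.Poly_Mapping"
begin

section \<open>Polynomials in \<open>w\<close> and their homogenization in \<open>x = (x\<^sub>0, w)\<close>\<close>

text \<open>
  Exponents of monomials in \<open>w \<in> \<real>\<^sup>n\<close> are elements of \<open>nat ^ 'n\<close>, points of \<open>\<real>\<^sup>1\<^sup>+\<^sup>n\<close>
  are pairs \<open>(x\<^sub>0, w)\<close>, and exponents of monomials in \<open>x\<close> are pairs \<open>(\<alpha>\<^sub>0, \<tau>)\<close>, added
  componentwise.  A polynomial is its finitely supported coefficient function; the monomials
  occurring in it are its \<^const>\<open>Poly_Mapping.keys\<close>.
\<close>

type_synonym 'n wpoly = "(nat ^ 'n) \<Rightarrow>\<^sub>0 real"
type_synonym 'n xexp = "nat \<times> (nat ^ 'n)"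
type_synonym 'n xpoly = "'n xexp \<Rightarrow>\<^sub>0 real"

definition wdeg :: "nat ^ 'n::finite \<Rightarrow> nat" where
  "wdeg \<tau> = (\<Sum>j\<in>UNIV. \<tau> $ j)"

definition xdeg :: "'n::finite xexp \<Rightarrow> nat" where
  "xdeg \<alpha> = fst \<alpha> + wdeg (snd \<alpha>)"

definition wmonomial :: "nat ^ 'n::finite \<Rightarrow> real ^ 'n \<Rightarrow> real" where
  "wmonomial \<tau> w = (\<Prod>j\<in>UNIV. w $ j ^ \<tau> $ j)"

definition xmonomial :: "'n::finite xexp \<Rightarrow> real \<times> (real ^ 'n) \<Rightarrow> real" where
  "xmonomial \<alpha> x = fst x ^ fst \<alpha> * wmonomial (snd \<alpha>) (snd x)"

definition weval :: "'n::finite wpoly \<Rightarrow> real ^ 'n \<Rightarrow> real" where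
  "weval f w = (\<Sum>\<tau>\<in>Poly_Mapping.keys f. Poly_Mapping.lookup f \<tau> * wmonomial \<tau> w)"

definition xeval :: "'n::finite xpoly \<Rightarrow> real \<times> (real ^ 'n) \<Rightarrow> real" where
  "xeval g x = (\<Sum>\<alpha>\<in>Poly_Mapping.keys g. Poly_Mapping.lookup g \<alpha> * xmonomial \<alpha> x)"

definition total_degree :: "'n::finite wpoly \<Rightarrow> nat" where
  "total_degree f = Max (insert 0 (wdeg ` Poly_Mapping.keys f))"

text \<open>
  The natural-number subtraction is exact when \<open>total_degree f \<le> 2 * \<omega>\<close>; the lemmas below
  confirm that the result is then the homogeneous polynomial of degree \<open>2 * \<omega>\<close> that restricts
  to \<open>f\<close> on \<open>x\<^sub>0 = 1\<close>.
\<close>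

definition homogenize :: "nat \<Rightarrow> 'n::finite wpoly \<Rightarrow> 'n xpoly" where
  "homogenize \<omega> f =
     (\<Sum>\<tau>\<in>Poly_Mapping.keys f.
        Poly_Mapping.single (2 * \<omega> - wdeg \<tau>, \<tau>) (Poly_Mapping.lookup f \<tau>))"

lemma lookup_homogenize:
  "Poly_Mapping.lookup (homogenize \<omega> f) (k, \<tau>) =
     (if k = 2 * \<omega> - wdeg \<tau> then Poly_Mapping.lookup f \<tau> else 0)"
proof -
  have "Poly_Mapping.lookup (homogenize \<omega> f) (k, \<tau>) =
      (\<Sum>\<sigma>\<in>Poly_Mapping.keys f.
         if \<sigma> = \<tau> then (if k = 2 * \<omega> - wdeg \<tau> then Poly_Mapping.lookup f \<tau> else 0) else 0)"
    unfolding homogenize_def lookup_sum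
    by (rule sum.cong) (auto simp: lookup_single when_def)
  then show ?thesis
    by (simp add: in_keys_iff)
qed

lemma keys_homogenize:
  "Poly_Mapping.keys (homogenize \<omega> f) = (\<lambda>\<tau>. (2 * \<omega> - wdeg \<tau>, \<tau>)) ` Poly_Mapping.keys f"
  by (auto simp: in_keys_iff lookup_homogenize image_iff split: if_splits)

lemma homogenize_homogeneous:
  assumes "total_degree f \<le> 2 * \<omega>" "\<alpha> \<in> Poly_Mapping.keys (homogenize \<omega> f)"
  shows "xdeg \<alpha> = 2 * \<omega>"
proof -
  have "wdeg \<tau> \<le> 2 * \<omega>" if "\<tau> \<in> Poly_Mapping.keys f" for \<tau>
  proof -
    have "wdeg \<tau> \<le> total_degree f"
      unfolding total_degree_def using that by (intro Max_ge) auto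
    with assms(1) show ?thesis by linarith
  qed
  then show ?thesis
    using assms(2) by (auto simp: keys_homogenize xdeg_def)
qed

lemma xeval_homogenize:
  "xeval (homogenize \<omega> f) (t, w) =
     (\<Sum>\<tau>\<in>Poly_Mapping.keys f. Poly_Mapping.lookup f \<tau> * (t ^ (2 * \<omega> - wdeg \<tau>) * wmonomial \<tau> w))"
  unfolding xeval_def keys_homogenize
  by (subst sum.reindex) (auto simp: inj_on_def lookup_homogenize xmonomial_def)

lemma xeval_homogenize_one: "xeval (homogenize \<omega> f) (1, w) = weval f w"
  by (simp add: xeval_homogenize weval_def)


section \<open>The completely positive cone and its faces\<close>

definition nonneg_w :: "(real ^ 'n::finite) set" where
  "nonneg_w = {w. \<forall>j. 0 \<le> w $ j}"

definition nonneg_x :: "(real \<times> (real ^ 'n::finite)) set" where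
  "nonneg_x = {x. 0 \<le> fst x \<and> snd x \<in> nonneg_w}"

text \<open>The set \<open>\<A>\<^sub>\<omega>\<close> of all exponents of degree \<open>\<omega>\<close>.\<close>

definition exponents :: "nat \<Rightarrow> ('n::finite xexp) set" where
  "exponents \<omega> = {\<alpha>. xdeg \<alpha> = \<omega>}"

text \<open>
  The finite nonempty set \<open>\<A>\<close> of exponents is enumerated by a bijection \<open>a\<close> from a finite index
  type \<open>'k\<close> onto \<open>\<A>\<close>.  Matrices indexed by \<open>\<A> \<times> \<A>\<close> thus become elements of \<open>real ^ 'k ^ 'k\<close>,
  whose standard inner product is \<open>\<langle>A, B\<rangle> = \<Sum>\<^sub>\<alpha>\<^sub>\<beta> A\<^sub>\<alpha>\<^sub>\<beta> B\<^sub>\<alpha>\<^sub>\<beta>\<close>.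
\<close>

definition uvec :: "('k \<Rightarrow> 'n::finite xexp) \<Rightarrow> real \<times> (real ^ 'n) \<Rightarrow> real ^ 'k" where
  "uvec a x = (\<chi> i. xmonomial (a i) x)"

definition umat :: "('k::finite \<Rightarrow> 'n::finite xexp) \<Rightarrow> real \<times> (real ^ 'n) \<Rightarrow> real ^ 'k ^ 'k" where
  "umat a x = (columnvector (uvec a x) :: real ^ 1 ^ 'k) ** rowvector (uvec a x)"

definition Gam :: "('k::finite \<Rightarrow> 'n::finite xexp) \<Rightarrow> (real ^ 'k ^ 'k) set" where
  "Gam a = umat a ` nonneg_x"

definition CPP :: "('k::finite \<Rightarrow> 'n::finite xexp) \<Rightarrow> (real ^ 'k ^ 'k) set" where
  "CPP a = convex hull (Gam a)"

text \<open>
  Faces of convex cones in the midpoint form (not the library's \<open>face_of\<close>, which is stated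
  for arbitrary convex sets via open segments).
\<close>

definition cone_face :: "'a::real_vector set \<Rightarrow> 'a set \<Rightarrow> bool" where
  "cone_face J C \<longleftrightarrow>
     convex_cone J \<and> convex_cone C \<and> J \<subseteq> C \<and>
     (\<forall>X1\<in>C. \<forall>X2\<in>C. (1/2) *\<^sub>R X1 + (1/2) *\<^sub>R X2 \<in> J \<longrightarrow> X1 \<in> J \<and> X2 \<in> J)"


section \<open>The cones \<open>\<J>\<^sub>p\<close> and the feasible sets\<close>

primrec JJ :: "('k::finite \<Rightarrow> 'n::finite xexp) \<Rightarrow> (nat \<Rightarrow> real ^ 'k ^ 'k) \<Rightarrow> nat \<Rightarrow> (real ^ 'k ^ 'k) set" where
  "JJ a Q 0 = CPP a"
| "JJ a Q (Suc p) = {X \<in> JJ a Q p. Q (Suc p) \<bullet> X = 0}"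

primrec S_set :: "(nat \<Rightarrow> 'n::finite wpoly) \<Rightarrow> nat \<Rightarrow> (real ^ 'n) set" where
  "S_set f 0 = nonneg_w"
| "S_set f (Suc p) = {w \<in> S_set f p. weval (f (Suc p)) w = 0}"

primrec S_tilde :: "nat \<Rightarrow> (nat \<Rightarrow> 'n::finite wpoly) \<Rightarrow> nat \<Rightarrow> (real ^ 'n) set" where
  "S_tilde \<omega> f 0 = nonneg_w"
| "S_tilde \<omega> f (Suc p) = {w \<in> S_tilde \<omega> f p. xeval (homogenize \<omega> (f (Suc p))) (0, w) = 0}"

primrec S_bar :: "nat \<Rightarrow> (nat \<Rightarrow> 'n::finite wpoly) \<Rightarrow> nat \<Rightarrow> (real \<times> (real ^ 'n)) set" where
  "S_bar \<omega> f 0 = nonneg_x"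
| "S_bar \<omega> f (Suc p) = {x \<in> S_bar \<omega> f p. xeval (homogenize \<omega> (f (Suc p))) x = 0}"

end

(* Any convex hull representation of X in the face J_(p-1) only uses rank-one matrices u(x)u(x)^T
   of J_(p-1), that is, points x of the homogenized feasible set, on which bar f_p is nonnegative.
   Hence <Q^p, _> is nonnegative on J_(p-1), and J_p is its zero set there.  For (ii),
   a point (t, w) with t > 0 is rescaled to (1, w/t). *)
theory Submission
  imports Defs
begin

lemma cone_face_trans:
  assumes "cone_face J K" "cone_face K C"
  shows "cone_face J C"
  using assms unfolding cone_face_def by blast

text \<open>Two nonnegative numbers with average zero both vanish.\<close>

lemma cone_face_zero_set:
  fixes J :: "'a::real_inner set"
  assumes J: "convex_cone J" and nonneg: "\<And>X. X \<in> J \<Longrightarrow> 0 \<le> q \<bullet> X"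
  shows "cone_face {X \<in> J. q \<bullet> X = 0} J"
proof -
  have "convex_cone {X \<in> J. q \<bullet> X = 0}"
    using J unfolding convex_cone_iff by (auto simp: inner_add_right)
  moreover have "q \<bullet> X1 = 0 \<and> q \<bullet> X2 = 0"
    if "X1 \<in> J" "X2 \<in> J" "q \<bullet> ((1/2) *\<^sub>R X1 + (1/2) *\<^sub>R X2) = 0" for X1 X2
    using that nonneg[of X1] nonneg[of X2] by (simp add: inner_add_right)
  ultimately show ?thesis
    using J unfolding cone_face_def by blast
qed

text \<open>\<open>cone_face\<close> speaks of midpoints only. Since \<open>C\<close> is a cone,
  \<open>2 * u\<close> and \<open>2 * v\<close> can be absorbed into \<open>X\<close> and
  \<open>Y\<close>, which makes the combination a midpoint; since \<open>J\<close> is a cone, the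
  factors can then be divided out.\<close>

lemma cone_face_combination:
  assumes face: "cone_face J C" and XY: "X \<in> C" "Y \<in> C"
    and uv: "0 < u" "0 < v" and J: "u *\<^sub>R X + v *\<^sub>R Y \<in> J"
  shows "X \<in> J" "Y \<in> J"
proof -
  have C: "convex_cone C" and Jc: "convex_cone J"
    using face by (auto simp: cone_face_def)
  have "(2 * u) *\<^sub>R X \<in> C" "(2 * v) *\<^sub>R Y \<in> C"
    using XY uv by (auto intro!: convex_cone_scaleR[OF C])
  moreover have "(1/2) *\<^sub>R ((2 * u) *\<^sub>R X) + (1/2) *\<^sub>R ((2 * v) *\<^sub>R Y) \<in> J"
    using J by simp
  ultimately have *: "(2 * u) *\<^sub>R X \<in> J" "(2 * v) *\<^sub>R Y \<in> J"
    using face unfolding cone_face_def by blast+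
  show "X \<in> J"
    using convex_cone_scaleR[OF Jc _ *(1), of "1 / (2 * u)"] uv by simp
  show "Y \<in> J"
    using convex_cone_scaleR[OF Jc _ *(2), of "1 / (2 * v)"] uv by simp
qed

lemma cone_face_hull_nonneg:
  fixes G J :: "'a::real_inner set"
  assumes face: "cone_face J (convex hull G)"
    and gens: "\<And>X. X \<in> G \<inter> J \<Longrightarrow> 0 \<le> q \<bullet> X"
    and X: "X \<in> J"
  shows "0 \<le> q \<bullet> X"
proof -
  \<comment> \<open>The implication is what makes this set convex: a combination outside
    \<open>J\<close> satisfies it vacuously, and one inside \<open>J\<close> has both its points in
    \<open>J\<close> by the face property. As \<open>T\<close> contains \<open>G\<close>, it then
    contains the whole hull.\<close>
  define T where "T = {Y \<in> convex hull G. Y \<in> J \<longrightarrow> 0 \<le> q \<bullet> Y}"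
  have "convex T"
  proof (rule convexI)
    fix Y Z :: 'a and u v :: real
    assume YZ: "Y \<in> T" "Z \<in> T" and uv: "0 \<le> u" "0 \<le> v" "u + v = 1"
    have hull: "Y \<in> convex hull G" "Z \<in> convex hull G"
      using YZ by (auto simp: T_def)
    show "u *\<^sub>R Y + v *\<^sub>R Z \<in> T"
    \<comment> \<open>A point of weight zero need not lie in \<open>J\<close>, so the face property
      is applied to strictly positive weights only.\<close>
    proof (cases "u = 0 \<or> v = 0")
      case True
      then show ?thesis
        using YZ uv by auto
    next
      case False
      then have pos: "0 < u" "0 < v"
        using uv by auto
      have "0 \<le> q \<bullet> (u *\<^sub>R Y + v *\<^sub>R Z)" if "u *\<^sub>R Y + v *\<^sub>R Z \<in> J"
        using cone_face_combination[OF face hull pos that] YZ uv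
        by (simp add: T_def inner_add_right)
      moreover have "u *\<^sub>R Y + v *\<^sub>R Z \<in> convex hull G"
        using convexD[OF convex_convex_hull hull uv] .
      ultimately show ?thesis
        by (simp add: T_def)
    qed
  qed
  moreover have "G \<subseteq> T"
    using gens by (auto simp: T_def hull_inc)
  ultimately have "convex hull G \<subseteq> T"
    by (simp add: hull_minimal)
  then show ?thesis
    using X face by (auto simp: T_def cone_face_def)
qed

lemma wmonomial_scaleR: "wmonomial \<tau> (c *\<^sub>R w) = c ^ wdeg \<tau> * wmonomial \<tau> w"
  by (simp add: wmonomial_def wdeg_def power_mult_distrib prod.distrib power_sum)

lemma wdeg_le_total_degree:
  assumes "\<tau> \<in> Poly_Mapping.keys f"
  shows "wdeg \<tau> \<le> total_degree f"
  unfolding total_degree_def using assms by (intro Max_ge) auto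

text \<open>The degree bound makes the subtraction in each exponent of \<open>t\<close> exact, so
  \<open>t ^ (2 * \<omega>)\<close> factors out of every term.\<close>

lemma xeval_homogenize_dehomogenize:
  assumes deg: "total_degree f \<le> 2 * \<omega>" and t: "t \<noteq> 0"
  shows "xeval (homogenize \<omega> f) (t, w) = t ^ (2 * \<omega>) * weval f (inverse t *\<^sub>R w)"
proof -
  have "t ^ (2 * \<omega> - wdeg \<tau>) = t ^ (2 * \<omega>) * inverse t ^ wdeg \<tau>"
    if "\<tau> \<in> Poly_Mapping.keys f" for \<tau>
    using wdeg_le_total_degree[OF that] deg t
    by (simp add: power_diff power_inverse divide_inverse)
  then show ?thesis
    unfolding xeval_homogenize weval_def wmonomial_scaleR sum_distrib_left
    by (intro sum.cong) (auto simp: mult_ac)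
qed

lemma S_bar_subset_nonneg_x: "S_bar \<omega> f k \<subseteq> nonneg_x"
  by (induction k) auto

text \<open>On a rank-one matrix \<open>umat a x\<close>, each linear equation defining
  \<open>JJ\<close> reads as the polynomial equation defining \<open>S_bar\<close> at
  \<open>x\<close>.\<close>

lemma umat_in_JJ_imp_S_bar:
  assumes "\<forall>i\<le>k. \<forall>x. xeval (homogenize \<omega> (f i)) x = Q i \<bullet> umat a x"
    and "x \<in> nonneg_x" "umat a x \<in> JJ a Q k"
  shows "x \<in> S_bar \<omega> f k"
  \<comment> \<open>Splitting the quantified pair \<open>x\<close> would keep the representation
    hypothesis from rewriting terms in an unsplit \<open>x\<close>.\<close>
  using assms by (induction k) (simp_all del: split_paired_All)

lemma S_bar_zero_iff: "(0, w) \<in> S_bar \<omega> f k \<longleftrightarrow> w \<in> S_tilde \<omega> f k"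
  by (induction k) (auto simp: nonneg_x_def)

text \<open>Scaling by a positive number preserves the orthant, and the factor
  \<open>t ^ (2 * \<omega>)\<close> is nonzero, so the equations carry over.\<close>

lemma S_bar_pos_imp_S_set:
  assumes "\<forall>i\<le>k. total_degree (f i) \<le> 2 * \<omega>" "0 < t" "(t, w) \<in> S_bar \<omega> f k"
  shows "inverse t *\<^sub>R w \<in> S_set f k"
  using assms
  by (induction k) (auto simp: nonneg_x_def nonneg_w_def xeval_homogenize_dehomogenize)

theorem theorem5p2:
  fixes f :: "nat \<Rightarrow> 'n::finite wpoly"
    and m \<omega> p :: nat
    and A :: "('n xexp) set"
    and a :: "'k::finite \<Rightarrow> 'n xexp"
    and Q :: "nat \<Rightarrow> real ^ 'k ^ 'k"
  assumes omega_pos: "0 < \<omega>"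
    and degrees: "\<forall>i\<le>m. total_degree (f i) \<le> 2 * \<omega>"
    and A_subset: "A \<subseteq> exponents \<omega>"
    and A_omega: "(\<omega>, 0) \<in> A"
    and A_monomials: "\<forall>i\<le>m. \<forall>\<gamma>\<in>Poly_Mapping.keys (homogenize \<omega> (f i)). \<exists>\<alpha>\<in>A. \<exists>\<beta>\<in>A. \<gamma> = \<alpha> + \<beta>"
    and A_enum: "bij_betw a UNIV A"
    and Q_sym: "\<forall>i\<le>m. transpose (Q i) = Q i"
    and Q_repr: "\<forall>i\<le>m. \<forall>x. xeval (homogenize \<omega> (f i)) x = Q i \<bullet> umat a x"
    and p_range: "p \<in> {1..m}"
    and face: "cone_face (JJ a Q (p - 1)) (CPP a)"
  shows "((INF x\<in>S_bar \<omega> f (p - 1). ereal (xeval (homogenize \<omega> (f p)) x)) \<ge> 0 \<longrightarrow>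
            cone_face (JJ a Q p) (JJ a Q (p - 1)) \<and> cone_face (JJ a Q p) (CPP a))
       \<and> ((INF w\<in>S_set f (p - 1). ereal (weval (f p) w)) \<ge> 0 \<and>
          (INF w\<in>S_tilde \<omega> f (p - 1). ereal (xeval (homogenize \<omega> (f p)) (0, w))) \<ge> 0 \<longrightarrow>
            cone_face (JJ a Q p) (JJ a Q (p - 1)) \<and> cone_face (JJ a Q p) (CPP a))"
proof -
  obtain k where k: "p = Suc k" "Suc k \<le> m"
    using p_range by (cases p) auto
  let ?g = "xeval (homogenize \<omega> (f p))"
  \<comment> \<open>Both parts of the theorem reduce to this pointwise bound.\<close>
  have faces: "cone_face (JJ a Q p) (JJ a Q (p - 1)) \<and> cone_face (JJ a Q p) (CPP a)"
    if nonneg: "\<And>x. x \<in> S_bar \<omega> f k \<Longrightarrow> 0 \<le> ?g x"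
  proof -
    have face_k: "cone_face (JJ a Q k) (convex hull (Gam a))"
      using face k by (simp add: CPP_def)
    have "0 \<le> Q p \<bullet> X" if X: "X \<in> Gam a \<inter> JJ a Q k" for X
    proof -
      obtain x where x: "x \<in> nonneg_x" "X = umat a x"
        using X unfolding Gam_def by blast
      have "\<forall>i\<le>k. \<forall>x. xeval (homogenize \<omega> (f i)) x = Q i \<bullet> umat a x"
        using Q_repr k by (meson Suc_leD order_trans)
      then have "x \<in> S_bar \<omega> f k"
        by (rule umat_in_JJ_imp_S_bar) (use x X in simp_all)
      moreover have "Q p \<bullet> X = ?g x"
        using Q_repr k x(2) by metis
      ultimately show ?thesis
        using nonneg by metis
    qed
    then have "0 \<le> Q p \<bullet> X" if "X \<in> JJ a Q k" for X
      using cone_face_hull_nonneg[OF face_k _ that] by blast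
    moreover have "convex_cone (JJ a Q k)"
      using face_k unfolding cone_face_def by blast
    ultimately have "cone_face {X \<in> JJ a Q k. Q p \<bullet> X = 0} (JJ a Q k)"
      by (rule cone_face_zero_set[rotated])
    then have "cone_face (JJ a Q p) (JJ a Q k)"
      by (simp add: k)
    with cone_face_trans[OF this] face k show ?thesis
      by simp
  qed
  \<comment> \<open>The hypotheses of (ii) imply the bound of (i): the slice \<open>t = 0\<close> is
    governed by \<open>S_tilde\<close>, the points with \<open>t > 0\<close> by
    \<open>S_set\<close>.\<close>
  have "0 \<le> ?g x"
    if S: "\<forall>w\<in>S_set f k. 0 \<le> weval (f p) w" and tilde: "\<forall>w\<in>S_tilde \<omega> f k. 0 \<le> ?g (0, w)"
      and x: "x \<in> S_bar \<omega> f k" for x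
  proof -
    obtain t w where tw: "x = (t, w)"
      by force
    show ?thesis
    proof (cases "t = 0")
      case True
      then show ?thesis
        using tilde x tw by (simp add: S_bar_zero_iff)
    next
      case False
      then have t: "0 < t"
        using x tw S_bar_subset_nonneg_x[of \<omega> f k] by (force simp: nonneg_x_def)
      have "\<forall>i\<le>k. total_degree (f i) \<le> 2 * \<omega>" and deg: "total_degree (f p) \<le> 2 * \<omega>"
        using degrees k by simp_all
      then have "inverse t *\<^sub>R w \<in> S_set f k"
        using t x tw by (blast intro: S_bar_pos_imp_S_set)
      then show ?thesis
        using S t deg tw by (simp add: xeval_homogenize_dehomogenize)
    qed
  qed
  moreover have "p - 1 = k"
    using k by simp
  ultimately show ?thesis
    \<comment> \<open>In \<open>ereal\<close> an infimum over the empty set is infinite, so each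
      infimum condition is equivalent to pointwise nonnegativity even on an empty set.\<close>
    unfolding le_INF_iff zero_ereal_def ereal_less_eq using faces by metis
qed

end
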